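(* Let $X$ be a separably metrizable space and let $\beta$ be the strict topology on $C_b(X)$. Then $(C_b(X),\beta)$ is transseparable.
   Context: $C_b(X)$ is the space of bounded continuous real-valued functions on $X$. Strict topology $\beta$ on $C_b(X)$: let $\check{X}$ be the Stone-Čech compactification of $X$. For each compact $Q \subseteq \check{X}\setminus X$ (including $Q=\emptyset$) let $\beta_Q$ be the locally convex topology on $C_b(X)$ generated by the seminorms $f \mapsto \sup_{x\in X}|h(x)f(x)|$, where $h$ ranges over the continuous functions on $\check{X}$ vanishing on $Q$. Then $\beta$ is the finest locally convex topology on $C_b(X)$ that is coarser than $\beta_Q$ for every such $Q$. A locally convex space $E$ is transseparable if for every neighbourhood $U$ of $0$ in $E$ there is a countable set $A\subseteq E$ with $E = A+U$. *)

theory Defs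
  imports "HOL-Analysis.Analysis"
begin

section \<open>Locally convex topologies\<close>

definition locally_convex_topology :: "'b::real_vector topology \<Rightarrow> bool" where
  "locally_convex_topology T \<longleftrightarrow>
     topspace T = UNIV \<and>
     continuous_map (prod_topology T T) T (\<lambda>(x, y). x + y) \<and>
     continuous_map (prod_topology euclideanreal T) T (\<lambda>(c, x). c *\<^sub>R x) \<and>
     neighbourhood_base_at 0 convex T"

definition coarser_topology :: "'b topology \<Rightarrow> 'b topology \<Rightarrow> bool" where
  "coarser_topology S T \<longleftrightarrow> topspace S = topspace T \<and> (\<forall>U. openin S U \<longrightarrow> openin T U)"

text \<open>The finite intersections of the semiballs below form a basis. The set \<^term>\<open>UNIV\<close> is
  included only so that the empty family generates the indiscrete topology.\<close>

definition seminorm_topology :: "('b::real_vector \<Rightarrow> real) set \<Rightarrow> 'b topology" where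
  "seminorm_topology P =
     topology_generated_by (insert UNIV {{g. p (g - f) < e} |p f e. p \<in> P \<and> e > 0})"

definition transseparable :: "'b::real_vector topology \<Rightarrow> bool" where
  "transseparable T \<longleftrightarrow>
     (\<forall>U. (\<exists>V. openin T V \<and> 0 \<in> V \<and> V \<subseteq> U) \<longrightarrow>
        (\<exists>A. countable A \<and> {a + u |a u. a \<in> A \<and> u \<in> U} = UNIV))"


section \<open>The Stone--Cech compactification\<close>

text \<open>A point of \<open>X\<close> is sent to its evaluation functional on the bounded continuous functions, and
  the compactification is the closure of the image. The topology on the function type
  \<^typ>\<open>('a::topological_space \<Rightarrow>\<^sub>C real) \<Rightarrow> real\<close> is the product topology.
  When \<open>X\<close> is Tychonoff, \<open>stone_cech_map\<close> identifies \<open>X\<close> with a dense subspace.\<close>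

definition stone_cech_map :: "'a::topological_space \<Rightarrow> ('a \<Rightarrow>\<^sub>C real) \<Rightarrow> real" where
  "stone_cech_map x = (\<lambda>f. apply_bcontfun f x)"

definition stone_cech :: "(('a::topological_space \<Rightarrow>\<^sub>C real) \<Rightarrow> real) set" where
  "stone_cech = closure (range stone_cech_map)"

lemma compact_stone_cech: "compact (stone_cech :: (('a::topological_space \<Rightarrow>\<^sub>C real) \<Rightarrow> real) set)"
proof -
  let ?K = "PiE UNIV (\<lambda>f::'a \<Rightarrow>\<^sub>C real. {- norm f..norm f})"
  have "compactin (product_topology (\<lambda>_. euclideanreal) UNIV) ?K"
    by (simp add: compactin_PiE)
  hence K: "compact ?K"
    by (simp add: euclidean_product_topology)
  have "closedin (product_topology (\<lambda>_. euclideanreal) UNIV) ?K"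
    by (simp add: closedin_product_topology)
  hence "closed ?K"
    by (simp add: euclidean_product_topology)
  moreover have "f x \<in> {- norm f..norm f}" for f :: "'a \<Rightarrow>\<^sub>C real" and x
    using norm_bounded[of f x] by (simp add: abs_le_iff minus_le_iff)
  hence "range stone_cech_map \<subseteq> ?K"
    unfolding stone_cech_map_def by blast
  ultimately have "stone_cech \<subseteq> ?K"
    unfolding stone_cech_def by (rule closure_minimal[rotated])
  hence "stone_cech = ?K \<inter> stone_cech" by blast
  also have "compact \<dots>"
    using K by (rule compact_Int_closed) (simp add: stone_cech_def)
  finally show ?thesis .
qed

lemma stone_cech_extension:
  fixes f :: "'a::topological_space \<Rightarrow>\<^sub>C real"
  shows "\<exists>g. continuous_on stone_cech g \<and> (\<forall>x. g (stone_cech_map x) = f x)"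
  by (rule exI[of _ "\<lambda>\<phi>. \<phi> f"])
     (auto simp: stone_cech_map_def intro: continuous_on_subset[OF continuous_on_product_coordinates])

lemma embedding_map_stone_cech_map:
  assumes "completely_regular_space (euclidean :: 'a::topological_space topology)"
    and "t1_space (euclidean :: 'a topology)"
  shows "embedding_map euclidean euclidean (stone_cech_map :: 'a \<Rightarrow> _)"
proof -
  let ?e = "stone_cech_map :: 'a \<Rightarrow> _"
  have sep: "\<exists>f::'a \<Rightarrow>\<^sub>C real. f x = 0 \<and> (\<forall>y. y \<notin> U \<longrightarrow> f y = 1)"
    if U: "open U" "x \<in> U" for U x
  proof -
    obtain g where g: "continuous_map euclidean (top_of_set {0..1::real}) g"
        "g x = 0" "g ` (- U) \<subseteq> {1}"
      using assms(1)[unfolded completely_regular_space_def, rule_format, of "- U" x] U by auto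
    have "continuous_on UNIV g" "bounded (range g)"
      using g(1) bounded_subset[OF bounded_closed_interval[of 0 "1::real"], of "range g"]
      by (auto simp: continuous_map_in_subtopology)
    then obtain f :: "'a \<Rightarrow>\<^sub>C real" where "apply_bcontfun f = g"
      using Bcontfun_inverse[of g] by (auto simp: bcontfun_def)
    with g show ?thesis by (intro exI[of _ f]) auto
  qed
  have inj: "inj ?e"
  proof (rule injI, rule ccontr)
    fix x y :: 'a assume eq: "?e x = ?e y" and "x \<noteq> y"
    then obtain U where "open U" "x \<in> U" "y \<notin> U"
      using assms(2) by (auto simp: t1_space_def)
    then obtain f :: "'a \<Rightarrow>\<^sub>C real" where "f x = 0" "f y = 1" using sep by blast
    thus False using fun_cong[OF eq, of f] by (simp add: stone_cech_map_def)
  qed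
  have cont: "continuous_on UNIV ?e"
    unfolding stone_cech_map_def by (intro continuous_on_coordinatewise_then_product) auto
  have "openin (top_of_set (range ?e)) (?e ` U)" if "open U" for U
  proof (subst openin_subopen, clarify)
    fix x assume "x \<in> U"
    then obtain f :: "'a \<Rightarrow>\<^sub>C real" where f: "f x = 0" "\<And>y. y \<notin> U \<Longrightarrow> f y = 1"
      using sep \<open>open U\<close> by blast
    let ?V = "{\<phi> :: ('a \<Rightarrow>\<^sub>C real) \<Rightarrow> real. \<phi> f < 1}"
    have "open ?V"
      by (intro open_Collect_less continuous_on_product_coordinates continuous_on_const)
    hence "openin (top_of_set (range ?e)) (range ?e \<inter> ?V)" by (rule openin_open_Int)
    moreover have "?e x \<in> range ?e \<inter> ?V" using f by (simp add: stone_cech_map_def)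
    moreover have "range ?e \<inter> ?V \<subseteq> ?e ` U"
      using f by (force simp: stone_cech_map_def)
    ultimately show "\<exists>T. openin (top_of_set (range ?e)) T \<and> ?e x \<in> T \<and> T \<subseteq> ?e ` U" by blast
  qed
  hence "open_map euclidean (top_of_set (range ?e)) ?e" by (simp add: open_map_def)
  thus ?thesis
    unfolding embedding_map_def using inj cont
    by (intro bijective_open_imp_homeomorphic_map) (auto simp: continuous_map_in_subtopology)
qed


section \<open>The strict topology\<close>

definition strict_seminorm ::
    "((('a::topological_space \<Rightarrow>\<^sub>C real) \<Rightarrow> real) \<Rightarrow> real) \<Rightarrow> ('a \<Rightarrow>\<^sub>C real) \<Rightarrow> real" where
  "strict_seminorm h f = (SUP x. \<bar>h (stone_cech_map x) * f x\<bar>)"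

definition beta_Q ::
    "(('a::topological_space \<Rightarrow>\<^sub>C real) \<Rightarrow> real) set \<Rightarrow> ('a \<Rightarrow>\<^sub>C real) topology" where
  "beta_Q Q =
     seminorm_topology (strict_seminorm ` {h. continuous_on stone_cech h \<and> (\<forall>q\<in>Q. h q = 0)})"

definition below_all_beta_Q :: "('a::topological_space \<Rightarrow>\<^sub>C real) topology \<Rightarrow> bool" where
  "below_all_beta_Q T \<longleftrightarrow>
     (\<forall>Q. compact Q \<and> Q \<subseteq> stone_cech - range stone_cech_map \<longrightarrow> coarser_topology T (beta_Q Q))"

definition is_strict_topology :: "('a::topological_space \<Rightarrow>\<^sub>C real) topology \<Rightarrow> bool" where
  "is_strict_topology T \<longleftrightarrow>
     locally_convex_topology T \<and> below_all_beta_Q T \<and>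
     (\<forall>S. locally_convex_topology S \<and> below_all_beta_Q S \<longrightarrow> coarser_topology S T)"

definition strict_topology :: "('a::topological_space \<Rightarrow>\<^sub>C real) topology" where
  "strict_topology = (THE T. is_strict_topology T)"

lemma topspace_beta_Q: "topspace (beta_Q Q) = UNIV"
  by (auto simp: beta_Q_def seminorm_topology_def)

lemma ex1_strict_topology: "\<exists>!T :: ('a::topological_space \<Rightarrow>\<^sub>C real) topology. is_strict_topology T"
proof (rule ex_ex1I)
  fix S T :: "('a \<Rightarrow>\<^sub>C real) topology"
  assume "is_strict_topology S" "is_strict_topology T"
  thus "S = T" unfolding is_strict_topology_def coarser_topology_def topology_eq by blast
next
  define L where "L = {T :: ('a \<Rightarrow>\<^sub>C real) topology. locally_convex_topology T \<and> below_all_beta_Q T}"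
  define \<B> where "\<B> = insert UNIV (\<Union>T\<in>L. {U. openin T U})"
  define S where "S = topology_generated_by \<B>"
  have top: "topspace S = UNIV" unfolding S_def \<B>_def by auto
  have openS: "openin S U" if "T \<in> L" "openin T U" for T U
    unfolding S_def \<B>_def by (rule topology_generated_by_Basis) (use that in auto)
  have idT: "continuous_map S T (\<lambda>x. x)" if "T \<in> L" for T
    using that openS top by (auto simp: continuous_map_def L_def locally_convex_topology_def)
  have coarseS: "below_all_beta_Q S"
    unfolding below_all_beta_Q_def coarser_topology_def
  proof (intro allI impI conjI)
    fix Q :: "(('a \<Rightarrow>\<^sub>C real) \<Rightarrow> real) set" and U
    assume Q: "compact Q \<and> Q \<subseteq> stone_cech - range stone_cech_map"
    show "topspace S = topspace (beta_Q Q)" by (simp add: top topspace_beta_Q)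
    assume "openin S U"
    hence "generate_topology_on \<B> U" unfolding S_def by (rule openin_topology_generated_by)
    thus "openin (beta_Q Q) U"
    proof induction
      case (Basis s)
      show ?case
      proof (cases "s = UNIV")
        case True thus ?thesis by (metis openin_topspace topspace_beta_Q)
      next
        case False thus ?thesis
          using Basis Q by (auto simp: \<B>_def L_def below_all_beta_Q_def coarser_topology_def)
      qed
    qed auto
  qed
  have gen: "continuous_map Z S f"
    if "topspace Z = UNIV" "\<And>T. T \<in> L \<Longrightarrow> continuous_map Z T f" for Z :: "'z topology" and f
    unfolding S_def
  proof (rule continuous_on_generated_topo)
    fix U assume "U \<in> \<B>"
    show "openin Z (f -` U \<inter> topspace Z)"
    proof (cases "U = UNIV")
      case True thus ?thesis by simp
    next
      case False
      then obtain T where "T \<in> L" "openin T U" using \<open>U \<in> \<B>\<close> by (auto simp: \<B>_def)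
      thus ?thesis using that(2)[of T] by (auto simp: continuous_map_alt)
    qed
  qed (auto simp: \<B>_def)
  have "continuous_map (prod_topology S S) S (\<lambda>(x, y). x + y)"
  proof (rule gen)
    fix T assume T: "T \<in> L"
    have "continuous_map (prod_topology S S) (prod_topology T T) (\<lambda>(x, y). (x, y))"
      using idT[OF T] by (intro continuous_map_prod_top[THEN iffD2]) auto
    moreover have "continuous_map (prod_topology T T) T (\<lambda>(x, y). x + y)"
      using T by (simp add: L_def locally_convex_topology_def)
    ultimately show "continuous_map (prod_topology S S) T (\<lambda>(x, y). x + y)"
      by (drule_tac continuous_map_compose) (auto simp: o_def case_prod_unfold)
  qed (simp add: top)
  moreover have "continuous_map (prod_topology euclideanreal S) S (\<lambda>(c, x). c *\<^sub>R x)"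
  proof (rule gen)
    fix T assume T: "T \<in> L"
    have "continuous_map (prod_topology euclideanreal S) (prod_topology euclideanreal T)
            (\<lambda>(x, y). (x, y))"
      using idT[OF T] by (intro continuous_map_prod_top[THEN iffD2]) auto
    moreover have "continuous_map (prod_topology euclideanreal T) T (\<lambda>(c, x). c *\<^sub>R x)"
      using T by (simp add: L_def locally_convex_topology_def)
    ultimately show "continuous_map (prod_topology euclideanreal S) T (\<lambda>(c, x). c *\<^sub>R x)"
      by (drule_tac continuous_map_compose) (auto simp: o_def case_prod_unfold)
  qed (simp add: top)
  moreover have "neighbourhood_base_at 0 convex S"
    unfolding neighbourhood_base_at_def
  proof (intro allI impI, elim conjE)
    fix W assume "openin S W" and "0 \<in> W"
    from \<open>openin S W\<close> have "generate_topology_on \<B> W"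
      unfolding S_def by (rule openin_topology_generated_by)
    thus "\<exists>U V. openin S U \<and> convex V \<and> 0 \<in> U \<and> U \<subseteq> V \<and> V \<subseteq> W" using \<open>0 \<in> W\<close>
    proof induction
      case (Int a b)
      obtain U V where U: "openin S U" "convex V" "0 \<in> U" "U \<subseteq> V" "V \<subseteq> a"
        using Int.IH(1) Int.prems by (metis IntD1)
      obtain U' V' where U': "openin S U'" "convex V'" "0 \<in> U'" "U' \<subseteq> V'" "V' \<subseteq> b"
        using Int.IH(2) Int.prems by (metis IntD2)
      have "openin S (U \<inter> U')" "convex (V \<inter> V')" "0 \<in> U \<inter> U'"
        using U U' by (simp_all add: convex_Int openin_Int)
      moreover have "U \<inter> U' \<subseteq> V \<inter> V'" "V \<inter> V' \<subseteq> a \<inter> b"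
        using U U' by blast+
      ultimately show ?case by (intro exI conjI)
    next
      case (UN K)
      then obtain k where "k \<in> K" "0 \<in> k" by blast
      with UN.IH[of k] show ?case by (metis Union_upper subset_trans)
    next
      case (Basis s)
      show ?case
      proof (cases "s = UNIV")
        case True
        thus ?thesis using top by (intro exI[of _ UNIV]) (auto intro: openin_topspace[of S, unfolded top])
      next
        case False
        then obtain T where T: "T \<in> L" "openin T s" using Basis by (auto simp: \<B>_def)
        hence "neighbourhood_base_at 0 convex T" by (simp add: L_def locally_convex_topology_def)
        then obtain U V where "openin T U" "convex V" "0 \<in> U" "U \<subseteq> V" "V \<subseteq> s"
          using T(2) Basis.prems unfolding neighbourhood_base_at_def by metis
        thus ?thesis using openS[OF T(1), of U] by blast
      qed
    qed auto
  qed
  ultimately have "locally_convex_topology S" by (simp add: locally_convex_topology_def top)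
  moreover have "coarser_topology T S" if "locally_convex_topology T" "below_all_beta_Q T" for T
    using that openS[of T] top
    by (auto simp: coarser_topology_def L_def locally_convex_topology_def)
  ultimately have "is_strict_topology S" using coarseS by (simp add: is_strict_topology_def)
  thus "\<exists>T :: ('a \<Rightarrow>\<^sub>C real) topology. is_strict_topology T" ..
qed

lemma is_strict_topology_strict_topology: "is_strict_topology strict_topology"
  unfolding strict_topology_def by (rule theI'[OF ex1_strict_topology])

end

theory Submission
  imports Defs
begin

text \<open>A countable base of \<open>X\<close> yields a countable family of bump functions \<open>d\<close>, and hence a
  countable set of functions \<open>(\<Sum> c * d) / max (1/2) (\<Sum> d)\<close> with finite sums and rational \<open>c\<close>.
  This set is dense in the strict topology. Given a bounded continuous function \<open>f\<close>, the pairs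
  \<open>(c, d)\<close> for which \<open>f\<close> is close to \<open>c\<close> on the support of \<open>d\<close> cover \<open>X\<close> by the sets \<open>d > 1/2\<close>;
  the points of the Stone--Cech compactification that remain uncovered form a compact set \<open>Q\<close>
  missing \<open>X\<close>. If \<open>h\<close> vanishes on \<open>Q\<close>, finitely many pairs already cover the compact set where
  \<open>h\<close> is not small, and the corresponding combination is uniformly close to \<open>f\<close> there while
  staying bounded, independently of \<open>h\<close>, elsewhere.\<close>

section \<open>Neighbourhoods of 0 in the strict topology\<close>

lemma stone_cech_map_in_stone_cech: "stone_cech_map x \<in> stone_cech"
  unfolding stone_cech_def by (rule subsetD[OF closure_subset rangeI])

lemma bounded_on_stone_cech:
  fixes h :: "(('a::topological_space \<Rightarrow>\<^sub>C real) \<Rightarrow> real) \<Rightarrow> real"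
  assumes "continuous_on stone_cech h"
  obtains M where "M > 0" "\<And>x. \<bar>h (stone_cech_map x)\<bar> \<le> M"
proof -
  have "bounded (h ` stone_cech)"
    using compact_continuous_image[OF assms compact_stone_cech] by (rule compact_imp_bounded)
  then obtain M where "M > 0" "\<forall>y\<in>h ` stone_cech. norm y \<le> M"
    unfolding bounded_pos by blast
  thus ?thesis using stone_cech_map_in_stone_cech by (intro that[of M]) auto
qed

text \<open>A finite intersection of semiballs is handled by one weight: weights are merged by
  adding absolute values, and radii are absorbed by rescaling. A pointwise bound instead of the
  supremum spares later uses any boundedness condition.\<close>

lemma beta_Q_nhd_zero:
  fixes Q :: "(('a::topological_space \<Rightarrow>\<^sub>C real) \<Rightarrow> real) set"
  assumes "openin (beta_Q Q) U" "0 \<in> U"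
  shows "\<exists>h. continuous_on stone_cech h \<and> (\<forall>q\<in>Q. h q = 0) \<and>
           (\<forall>f. (\<forall>x. \<bar>h (stone_cech_map x) * apply_bcontfun f x\<bar> \<le> 1) \<longrightarrow> f \<in> U)"
proof -
  let ?P = "strict_seminorm ` {h. continuous_on stone_cech h \<and> (\<forall>q\<in>Q. h q = 0)}"
  have "generate_topology_on (insert UNIV {{g. p (g - f) < e} |p f e. p \<in> ?P \<and> e > 0}) U"
    using assms(1) unfolding beta_Q_def seminorm_topology_def by (rule openin_topology_generated_by)
  thus ?thesis using assms(2)
  proof induction
    case Empty
    thus ?case by simp
  next
    case (Int a b)
    from Int obtain h where h: "continuous_on stone_cech h" "\<forall>q\<in>Q. h q = 0"
        "\<And>f. (\<forall>x. \<bar>h (stone_cech_map x) * apply_bcontfun f x\<bar> \<le> 1) \<Longrightarrow> f \<in> a"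
      by auto
    from Int obtain k where k: "continuous_on stone_cech k" "\<forall>q\<in>Q. k q = 0"
        "\<And>f. (\<forall>x. \<bar>k (stone_cech_map x) * apply_bcontfun f x\<bar> \<le> 1) \<Longrightarrow> f \<in> b"
      by auto
    \<comment> \<open>This weight dominates both \<open>h\<close> and \<open>k\<close> and still
      vanishes on \<open>Q\<close>.\<close>
    let ?l = "\<lambda>\<phi>. \<bar>h \<phi>\<bar> + \<bar>k \<phi>\<bar>"
    have le: "\<bar>h \<phi> * c\<bar> \<le> \<bar>?l \<phi> * c\<bar>" "\<bar>k \<phi> * c\<bar> \<le> \<bar>?l \<phi> * c\<bar>" for \<phi> c
      by (auto simp: abs_mult intro!: mult_right_mono)
    have "f \<in> a \<inter> b" if "\<forall>x. \<bar>?l (stone_cech_map x) * f x\<bar> \<le> 1" for f :: "'a \<Rightarrow>\<^sub>C real"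
      using h(3)[of f] k(3)[of f] that le order_trans by blast
    moreover have "continuous_on stone_cech ?l"
      using h(1) k(1) by (intro continuous_intros)
    ultimately show ?case using h(2) k(2) by (intro exI[of _ ?l]) simp
  next
    case (UN K)
    then obtain k where k: "k \<in> K" "0 \<in> k" by blast
    obtain h where "continuous_on stone_cech h" "\<forall>q\<in>Q. h q = 0"
        "\<And>f. (\<forall>x. \<bar>h (stone_cech_map x) * apply_bcontfun f x\<bar> \<le> 1) \<Longrightarrow> f \<in> k"
      using UN.IH[OF k] by auto
    with k(1) show ?case by (intro exI[of _ h]) auto
  next
    case (Basis s)
    show ?case
    proof (cases "s = UNIV")
      case True
      thus ?thesis by (intro exI[of _ "\<lambda>_. 0"]) auto
    next
      case False
      then obtain h f e where h: "continuous_on stone_cech h" "\<forall>q\<in>Q. h q = 0"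
          and s: "s = {g. strict_seminorm h (g - f) < e}"
        using Basis by auto
      \<comment> \<open>The semiball is centred at \<open>f\<close>, not at 0. As 0 lies in
        \<open>s\<close>, \<open>strict_seminorm h (- f)\<close> is below \<open>e\<close>; using
        half of the gap keeps the final estimate strict.\<close>
      define r where "r = (e - strict_seminorm h (- f)) / 2"
      have r: "r > 0" using Basis s by (simp add: r_def)
      obtain M where M: "M > 0" "\<And>x. \<bar>h (stone_cech_map x)\<bar> \<le> M"
        using bounded_on_stone_cech[OF h(1)] by blast
      have bdd: "bdd_above (range (\<lambda>x. \<bar>h (stone_cech_map x) * (- f) x\<bar>))"
      proof (rule bdd_aboveI2)
        fix x
        show "\<bar>h (stone_cech_map x) * (- f) x\<bar> \<le> M * norm f"
          using M norm_bounded[of f x] by (auto simp: abs_mult intro!: mult_mono)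
      qed
      have "g \<in> s" if g: "\<forall>x. \<bar>h (stone_cech_map x) / r * g x\<bar> \<le> 1" for g :: "'a \<Rightarrow>\<^sub>C real"
      proof -
        have "strict_seminorm h (g - f) \<le> r + strict_seminorm h (- f)"
          unfolding strict_seminorm_def
        proof (rule cSUP_least)
          fix x
          have "\<bar>h (stone_cech_map x) * g x\<bar> \<le> r"
            using g[rule_format, of x] r by (simp add: abs_mult field_simps)
          moreover have "\<bar>h (stone_cech_map x) * (- f) x\<bar> \<le> (SUP x. \<bar>h (stone_cech_map x) * (- f) x\<bar>)"
            by (rule cSUP_upper[OF _ bdd]) simp
          moreover have "h (stone_cech_map x) * (g - f) x
              = h (stone_cech_map x) * g x + h (stone_cech_map x) * (- f) x"
            by (simp add: algebra_simps)
          ultimately show "\<bar>h (stone_cech_map x) * (g - f) x\<bar>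
              \<le> r + (SUP x. \<bar>h (stone_cech_map x) * (- f) x\<bar>)"
            by linarith
        qed simp
        also have "\<dots> < e" using r unfolding r_def by (simp add: field_simps)
        finally show ?thesis by (simp add: s)
      qed
      moreover have "continuous_on stone_cech (\<lambda>\<phi>. h \<phi> / r)"
        using h(1) r by (intro continuous_intros) auto
      ultimately show ?thesis using h(2) by (intro exI[of _ "\<lambda>\<phi>. h \<phi> / r"]) simp
    qed
  qed
qed

text \<open>Being coarser than every \<open>beta_Q\<close> leaves \<open>Q\<close> free: it may be
  chosen after \<open>U\<close> and fitted to the function to be approximated.\<close>

lemma strict_topology_nhd_zero:
  fixes Q :: "(('a::topological_space \<Rightarrow>\<^sub>C real) \<Rightarrow> real) set"
  assumes "openin strict_topology U" "0 \<in> U" "compact Q" "Q \<subseteq> stone_cech - range stone_cech_map"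
  obtains h where "continuous_on stone_cech h" "\<And>q. q \<in> Q \<Longrightarrow> h q = 0"
    "\<And>f. (\<And>x. \<bar>h (stone_cech_map x) * apply_bcontfun f x\<bar> \<le> 1) \<Longrightarrow> f \<in> U"
proof -
  have "openin (beta_Q Q) U"
    using is_strict_topology_strict_topology assms
    unfolding is_strict_topology_def below_all_beta_Q_def coarser_topology_def by blast
  from beta_Q_nhd_zero[OF this assms(2)] show ?thesis using that by blast
qed

text \<open>This is the case of empty \<open>Q\<close>: the weight is bounded because the
  compactification is compact.\<close>

lemma strict_topology_contains_norm_ball:
  fixes U :: "('a::topological_space \<Rightarrow>\<^sub>C real) set"
  assumes "openin strict_topology U" "0 \<in> U"
  obtains r where "r > 0" "\<And>f. (\<And>x. \<bar>apply_bcontfun f x\<bar> \<le> r) \<Longrightarrow> f \<in> U"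
proof -
  obtain h :: "_ \<Rightarrow> real" where h: "continuous_on stone_cech h"
    "\<And>f. (\<And>x. \<bar>h (stone_cech_map x) * apply_bcontfun f x\<bar> \<le> 1) \<Longrightarrow> f \<in> U"
    using strict_topology_nhd_zero[OF assms, of "{}"] by auto
  obtain M where M: "M > 0" "\<And>x. \<bar>h (stone_cech_map x)\<bar> \<le> M"
    using bounded_on_stone_cech[OF h(1)] by blast
  have "f \<in> U" if "\<And>x. \<bar>f x\<bar> \<le> 1 / M" for f :: "'a \<Rightarrow>\<^sub>C real"
  proof (rule h(2))
    fix x
    have "\<bar>h (stone_cech_map x) * f x\<bar> \<le> M * (1 / M)"
      unfolding abs_mult using M that by (intro mult_mono) auto
    thus "\<bar>h (stone_cech_map x) * f x\<bar> \<le> 1" using M by simp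
  qed
  thus ?thesis using that[of "1 / M"] M by simp
qed

section \<open>Countable bases and bump functions\<close>

lemma metrizable_separable_imp_second_countable:
  assumes "metrizable_space X" "separable_space X"
  shows "second_countable X"
proof -
  obtain M d where Md: "Metric_space M d" and X: "X = Metric_space.mtopology M d"
    using assms(1) unfolding metrizable_space_def by blast
  interpret Metric_space M d by (rule Md)
  obtain C where C: "countable C" "C \<subseteq> M" "mtopology closure_of C = M"
    using assms(2) by (auto simp: separable_space_def X)
  define \<B> where "\<B> = (\<lambda>(c, n). mball c (1 / real (Suc n))) ` (C \<times> UNIV)"
  have "countable \<B>" using C(1) by (simp add: \<B>_def)
  moreover have "openin X V" if "V \<in> \<B>" for V
    using that by (auto simp: \<B>_def X)
  moreover have "\<exists>V\<in>\<B>. x \<in> V \<and> V \<subseteq> U" if U: "openin X U" "x \<in> U" for U x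
  proof -
    obtain r where r: "r > 0" "mball x r \<subseteq> U" and "x \<in> M"
      using U unfolding X openin_mtopology by blast
    \<comment> \<open>Radius below \<open>r / 2\<close>: a ball about \<open>c\<close> that contains
      \<open>x\<close> then stays within distance \<open>r\<close> of \<open>x\<close>.\<close>
    obtain n where n: "1 / real (Suc n) < r / 2"
      using r(1) nat_approx_posE[of "r / 2"] by auto
    have "openin mtopology (mball x (1 / real (Suc n)))" "x \<in> mball x (1 / real (Suc n))"
      using \<open>x \<in> M\<close> by auto
    moreover have "mtopology closure_of C = topspace mtopology" using C(3) by simp
    ultimately have "C \<inter> mball x (1 / real (Suc n)) \<noteq> {}"
      unfolding dense_intersects_open by blast
    then obtain c where c: "c \<in> C" "c \<in> mball x (1 / real (Suc n))" by blast
    have "mball c (1 / real (Suc n)) \<subseteq> mball x r"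
    proof
      fix y assume "y \<in> mball c (1 / real (Suc n))"
      with c n triangle[of x c y] \<open>x \<in> M\<close> show "y \<in> mball x r" by auto
    qed
    moreover have "x \<in> mball c (1 / real (Suc n))" using c(2) by (simp add: commute)
    ultimately show ?thesis using c(1) r(2) unfolding \<B>_def by blast
  qed
  ultimately show ?thesis unfolding second_countable_def by blast
qed

text \<open>Functions are picked per pair \<open>(B, V)\<close> of base sets, not per point and
  neighbourhood. A bump at \<open>x\<close> supported in \<open>V\<close> exceeds 1/2 on some base
  set \<open>B\<close> around \<open>x\<close>, so the pair is admissible, and whichever function
  was picked for it also serves \<open>x\<close>.\<close>

lemma countable_bump_functions:
  assumes "completely_regular_space (euclidean :: 'a::topological_space topology)"
    and "second_countable (euclidean :: 'a topology)"
  obtains D :: "('a::topological_space \<Rightarrow>\<^sub>C real) set"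
  where "countable D" "\<And>d x. d \<in> D \<Longrightarrow> 0 \<le> apply_bcontfun d x"
    "\<And>U x. open U \<Longrightarrow> x \<in> U \<Longrightarrow> \<exists>d\<in>D. apply_bcontfun d x > 1/2 \<and> (\<forall>y. y \<notin> U \<longrightarrow> d y = 0)"
proof -
  obtain \<B> :: "'a set set" where \<B>: "countable \<B>" "\<And>V. V \<in> \<B> \<Longrightarrow> open V"
    "\<And>U x. open U \<Longrightarrow> x \<in> U \<Longrightarrow> \<exists>V\<in>\<B>. x \<in> V \<and> V \<subseteq> U"
    using assms(2) unfolding second_countable_def by (auto 0 4)
  define bump where "bump B U d \<longleftrightarrow> (\<forall>x. 0 \<le> d x) \<and> (\<forall>x\<in>B. d x > 1/2) \<and> (\<forall>y. y \<notin> U \<longrightarrow> d y = 0)"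
    for B U and d :: "'a \<Rightarrow>\<^sub>C real"
  define D where "D = (\<lambda>p. SOME d. bump (fst p) (snd p) d) ` {p \<in> \<B> \<times> \<B>. \<exists>d. bump (fst p) (snd p) d}"
  have bump: "bump B U (SOME d. bump B U d)" if "\<exists>d. bump B U d" for B U
    using that by (rule someI_ex)
  have "countable D"
    unfolding D_def by (intro countable_image countable_subset[OF _ countable_SIGMA[OF \<B>(1) \<B>(1)]]) auto
  moreover have "0 \<le> d x" if d: "d \<in> D" for d :: "'a \<Rightarrow>\<^sub>C real" and x
  proof -
    obtain B U where "d = (SOME d. bump B U d)" "\<exists>d. bump B U d"
      using d unfolding D_def by blast
    hence "bump B U d" using bump by metis
    thus ?thesis by (simp add: bump_def)
  qed
  moreover have "\<exists>d\<in>D. d x > 1/2 \<and> (\<forall>y. y \<notin> U \<longrightarrow> d y = 0)" if U: "open U" "x \<in> U" for U x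
  proof -
    obtain V where V: "V \<in> \<B>" "x \<in> V" "V \<subseteq> U" using \<B>(3) U by blast
    obtain g where g: "continuous_map euclidean (top_of_set {0..1::real}) g"
        "g x = 0" "g ` (- V) \<subseteq> {1}"
      using assms(1)[unfolded completely_regular_space_def, rule_format, of "- V" x] V \<B>(2) by auto
    have cont: "continuous_on UNIV g" and g01: "\<And>y. 0 \<le> g y \<and> g y \<le> 1"
      using g(1) by (auto simp: continuous_map_in_subtopology)
    have "(\<lambda>y. 1 - g y) \<in> bcontfun"
      using cont g01 by (intro bcontfun_normI[of _ 1]) (auto intro!: continuous_intros simp: abs_le_iff)
    then obtain d :: "'a \<Rightarrow>\<^sub>C real" where d: "apply_bcontfun d = (\<lambda>y. 1 - g y)"
      using Bcontfun_inverse by blast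
    have "open {y. g y < 1/2}" using cont by (intro open_Collect_less continuous_on_const)
    then obtain B where B: "B \<in> \<B>" "x \<in> B" "B \<subseteq> {y. g y < 1/2}"
      using \<B>(3)[of "{y. g y < 1/2}" x] g(2) by auto
    have "bump B V d" using B g g01 by (force simp: bump_def d)
    hence ex: "\<exists>d. bump B V d" ..
    hence "(SOME d. bump B V d) \<in> D"
      unfolding D_def using B V by (intro image_eqI[of _ _ "(B, V)"]) auto
    with bump[OF ex] obtain d where "d \<in> D" "bump B V d" by blast
    with B(2) V(3) show ?thesis unfolding bump_def by blast
  qed
  ultimately show ?thesis by (rule that)
qed

section \<open>Normalized combinations\<close>

text \<open>The cutoff \<open>1/2\<close> keeps the quotient continuous where all \<open>d\<close> vanish.\<close>

definition normalized_combination ::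
    "(real \<times> ('a::topological_space \<Rightarrow>\<^sub>C real)) set \<Rightarrow> 'a \<Rightarrow>\<^sub>C real" where
  "normalized_combination F =
     Bcontfun (\<lambda>x. (\<Sum>(c, d)\<in>F. c * apply_bcontfun d x) / max (1/2) (\<Sum>(c, d)\<in>F. apply_bcontfun d x))"

text \<open>The quotient is continuous and bounded because its denominator is at least 1/2. For
  infinite \<open>F\<close> both sums default to 0.\<close>

lemma normalized_combination_apply:
  "normalized_combination F x =
     (\<Sum>(c, d)\<in>F. c * apply_bcontfun d x) / max (1/2) (\<Sum>(c, d)\<in>F. apply_bcontfun d x)"
proof -
  let ?n = "\<lambda>x. \<Sum>(c, d)\<in>F. c * apply_bcontfun d x"
  let ?m = "\<lambda>x. max (1/2) (\<Sum>(c, d)\<in>F. apply_bcontfun d x)"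
  let ?b = "\<Sum>(c, d)\<in>F. \<bar>c\<bar> * norm d"
  have "(\<lambda>x. ?n x / ?m x) \<in> bcontfun"
  proof (rule bcontfun_normI)
    show "continuous_on UNIV (\<lambda>x. ?n x / ?m x)"
      unfolding case_prod_unfold by (intro continuous_intros) (auto simp: max_def)
    fix x
    have "\<bar>?n x\<bar> \<le> ?b"
      unfolding case_prod_unfold
      by (rule order_trans[OF sum_abs], rule sum_mono)
         (use norm_bounded[where 'b = real] in \<open>auto simp: abs_mult intro!: mult_left_mono\<close>)
    hence "\<bar>?n x\<bar> / ?m x \<le> ?b / (1/2)"
      by (intro frac_le) auto
    thus "norm (?n x / ?m x) \<le> ?b / (1/2)"
      by (simp add: abs_divide)
  qed
  thus ?thesis by (simp add: normalized_combination_def Bcontfun_inverse)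
qed

text \<open>The weights \<open>d x / max (1/2) (...)\<close> are nonnegative with total at most 1,
  so the bound does not grow with the number of terms.\<close>

lemma abs_normalized_combination_le:
  fixes F :: "(real \<times> ('a::topological_space \<Rightarrow>\<^sub>C real)) set"
  assumes "\<And>c d. (c, d) \<in> F \<Longrightarrow> \<bar>c\<bar> \<le> M" "\<And>c d. (c, d) \<in> F \<Longrightarrow> 0 \<le> d x" "0 \<le> M"
  shows "\<bar>normalized_combination F x\<bar> \<le> M"
proof -
  have "\<bar>\<Sum>(c, d)\<in>F. c * apply_bcontfun d x\<bar> \<le> (\<Sum>(c, d)\<in>F. M * apply_bcontfun d x)"
    unfolding case_prod_unfold
    by (rule order_trans[OF sum_abs], rule sum_mono)
       (use assms in \<open>auto simp: abs_mult intro!: mult_right_mono\<close>)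
  also have "\<dots> = M * (\<Sum>(c, d)\<in>F. apply_bcontfun d x)"
    by (simp add: sum_distrib_left case_prod_unfold)
  also have "\<dots> \<le> M * max (1/2) (\<Sum>(c, d)\<in>F. apply_bcontfun d x)"
    using assms(3) by (intro mult_left_mono) auto
  finally show ?thesis
    by (simp add: normalized_combination_apply abs_divide divide_le_eq max_def split: if_splits)
qed

text \<open>The term \<open>d0\<close> alone lifts the sum above the cutoff, so the value at
  \<open>x\<close> is a true weighted average of those \<open>c\<close> whose \<open>d\<close> is
  nonzero at \<open>x\<close>, all within \<open>e\<close> of \<open>y\<close>.\<close>

lemma normalized_combination_approx:
  fixes F :: "(real \<times> ('a::topological_space \<Rightarrow>\<^sub>C real)) set" and e y :: real
  assumes "finite F" "\<And>c d. (c, d) \<in> F \<Longrightarrow> 0 \<le> d x"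
    and "\<And>c d. (c, d) \<in> F \<Longrightarrow> apply_bcontfun d x \<noteq> 0 \<Longrightarrow> \<bar>y - c\<bar> \<le> e"
    and "(c0, d0) \<in> F" "d0 x > 1/2"
  shows "\<bar>y - normalized_combination F x\<bar> \<le> e"
proof -
  let ?s = "\<Sum>(c, d)\<in>F. apply_bcontfun d x"
  have "d0 x \<le> ?s"
    using member_le_sum[of "(c0, d0)" F "\<lambda>(c, d). apply_bcontfun d x"] assms by auto
  hence s: "?s > 1/2" using assms(5) by linarith
  have "\<bar>\<Sum>(c, d)\<in>F. (y - c) * apply_bcontfun d x\<bar> \<le> (\<Sum>(c, d)\<in>F. e * apply_bcontfun d x)"
    unfolding case_prod_unfold
  proof (rule order_trans[OF sum_abs], rule sum_mono)
    fix p assume "p \<in> F"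
    thus "\<bar>(y - fst p) * apply_bcontfun (snd p) x\<bar> \<le> e * apply_bcontfun (snd p) x"
      using assms(2,3)[of "fst p" "snd p"]
      by (cases "snd p x = 0") (auto simp: abs_mult intro!: mult_right_mono)
  qed
  also have "\<dots> = e * ?s"
    by (simp add: sum_distrib_left case_prod_unfold)
  also have "(\<Sum>(c, d)\<in>F. (y - c) * apply_bcontfun d x) = (y - normalized_combination F x) * ?s"
  proof -
    have "normalized_combination F x * ?s = (\<Sum>(c, d)\<in>F. c * apply_bcontfun d x)"
      using s by (simp add: normalized_combination_apply)
    thus ?thesis
      by (simp add: case_prod_unfold left_diff_distrib sum_subtractf sum_distrib_left)
  qed
  finally show ?thesis using s by (simp add: abs_mult)
qed

section \<open>Approximation by the countable set\<close>

theorem lemma1p8: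
  assumes "metrizable_space (euclidean :: 'a::topological_space topology)"
    and "separable_space (euclidean :: 'a topology)"
  shows "transseparable (strict_topology :: ('a \<Rightarrow>\<^sub>C real) topology)"
proof -
  have "completely_regular_space (euclidean :: 'a topology)" "second_countable (euclidean :: 'a topology)"
    using assms metrizable_imp_completely_regular_space metrizable_separable_imp_second_countable by blast+
  then obtain D :: "('a \<Rightarrow>\<^sub>C real) set" where D: "countable D" "\<And>d x. d \<in> D \<Longrightarrow> 0 \<le> apply_bcontfun d x"
    "\<And>U x. open U \<Longrightarrow> x \<in> U \<Longrightarrow> \<exists>d\<in>D. apply_bcontfun d x > 1/2 \<and> (\<forall>y. y \<notin> U \<longrightarrow> d y = 0)"
    using countable_bump_functions by blast
  define A where "A = normalized_combination ` {F. finite F \<and> F \<subseteq> \<rat> \<times> D}"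
  have "countable A"
    unfolding A_def using D(1) countable_rat
    by (intro countable_image countable_Collect_finite_subset countable_SIGMA)
  moreover have "{a + u |a u. a \<in> A \<and> u \<in> U} = UNIV"
    if V: "openin strict_topology V" "0 \<in> V" "V \<subseteq> U" for U V
  proof -
    have "neighbourhood_base_at 0 convex (strict_topology :: ('a \<Rightarrow>\<^sub>C real) topology)"
      using is_strict_topology_strict_topology[where 'a = 'a]
      by (simp add: is_strict_topology_def locally_convex_topology_def)
    then obtain W C where W: "openin strict_topology W" "0 \<in> W" and C: "convex C" "W \<subseteq> C" "C \<subseteq> V"
      using V unfolding neighbourhood_base_at_def by metis
    obtain r where r: "r > 0" "\<And>f. (\<And>x. \<bar>apply_bcontfun f x\<bar> \<le> r) \<Longrightarrow> f \<in> W"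
      using strict_topology_contains_norm_ball[OF W] by blast
    \<comment> \<open>The truncation at height \<open>e\<close> will be doubled before it is tested
      against the ball of radius \<open>r\<close>.\<close>
    define e where "e = r / 2"
    have e: "e > 0" using r by (simp add: e_def)
    have approx: "\<exists>a\<in>A. f - a \<in> U" for f :: "'a \<Rightarrow>\<^sub>C real"
    proof -
      \<comment> \<open>The bound on \<open>c\<close> keeps every finite combination from
        \<open>P\<close> within \<open>norm f + e\<close>, whichever \<open>F\<close> the weight
        \<open>h\<close> later dictates.\<close>
      define P where "P = {(c, d) \<in> \<rat> \<times> D. \<bar>c\<bar> \<le> norm f + e \<and> (\<forall>x. apply_bcontfun d x \<noteq> 0 \<longrightarrow> \<bar>f x - c\<bar> \<le> e)}"
      have cover: "\<exists>(c, d)\<in>P. apply_bcontfun d x > 1/2" for x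
      proof -
        \<comment> \<open>The error \<open>e\<close> is split evenly between the rational
          approximation of \<open>f x\<close> and the oscillation of \<open>f\<close> on the support
          of \<open>d\<close>.\<close>
        obtain c where c: "c \<in> \<rat>" "f x - e / 2 < c" "c < f x + e / 2"
          using Rats_dense_in_real[of "f x - e / 2" "f x + e / 2"] e by auto
        have "open {y. \<bar>f y - f x\<bar> < e / 2}"
          by (intro open_Collect_less continuous_intros continuous_on_apply_bcontfun)
        then obtain d where d: "d \<in> D" "d x > 1/2" "\<forall>y. d y \<noteq> 0 \<longrightarrow> \<bar>f y - f x\<bar> < e / 2"
          using D(3)[of "{y. \<bar>f y - f x\<bar> < e / 2}" x] e by auto
        have "\<bar>c\<bar> \<le> norm f + e" using norm_bounded[of f x] c e by auto
        moreover have "\<forall>y. d y \<noteq> 0 \<longrightarrow> \<bar>f y - c\<bar> \<le> e"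
        proof (intro allI impI)
          fix y assume "d y \<noteq> 0"
          with d(3) have "\<bar>f y - f x\<bar> < e / 2" by blast
          with c show "\<bar>f y - c\<bar> \<le> e" by arith
        qed
        ultimately show ?thesis using c d unfolding P_def by auto
      qed
      \<comment> \<open>The coordinate \<open>\<phi> d\<close> is the value at \<open>\<phi>\<close>
        of the continuous extension of \<open>d\<close> to the compactification.\<close>
      define Q where "Q = stone_cech \<inter> (\<Inter>(c, d)\<in>P. {\<phi>. \<phi> d \<le> 1/2})"
      have "compact Q"
        unfolding Q_def case_prod_unfold
        by (intro compact_Int_closed compact_stone_cech closed_INT ballI closed_Collect_le
            continuous_on_product_coordinates continuous_on_const)
      moreover have "Q \<subseteq> stone_cech - range stone_cech_map"
      proof -
        have "stone_cech_map x \<notin> Q" for x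
        proof -
          obtain c d where "(c, d) \<in> P" "d x > 1/2" using cover[of x] by auto
          thus ?thesis by (force simp: Q_def stone_cech_map_def)
        qed
        thus ?thesis by (auto simp: Q_def)
      qed
      ultimately obtain h where h: "continuous_on stone_cech h" "\<And>q. q \<in> Q \<Longrightarrow> h q = 0"
        "\<And>f. (\<And>x. \<bar>h (stone_cech_map x) * apply_bcontfun f x\<bar> \<le> 1) \<Longrightarrow> f \<in> W"
        using strict_topology_nhd_zero[OF W] by metis
      \<comment> \<open>\<open>M\<close> bounds the error of any such combination:
        \<open>norm f\<close> for \<open>f\<close> plus \<open>norm f + e\<close> for the
        combination.\<close>
      define M where "M = 2 * norm f + e"
      have M: "M > 0" using e by (simp add: M_def add_nonneg_pos)
      \<comment> \<open>Off \<open>K\<close> the weight is below \<open>1 / (2 * M)\<close> and the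
        doubled remainder is at most \<open>2 * M\<close>, so their product stays within 1.\<close>
      define K where "K = {\<phi> \<in> stone_cech. 1 / (2 * M) \<le> \<bar>h \<phi>\<bar>}"
      have "closedin (top_of_set stone_cech) (stone_cech \<inter> (\<lambda>\<phi>. \<bar>h \<phi>\<bar>) -` {1 / (2 * M)..})"
        using h(1) by (intro continuous_closedin_preimage continuous_intros) auto
      also have "stone_cech \<inter> (\<lambda>\<phi>. \<bar>h \<phi>\<bar>) -` {1 / (2 * M)..} = K" by (auto simp: K_def)
      finally have "compact K" by (rule closedin_compact[OF compact_stone_cech])
      moreover have "open {\<phi> :: ('a \<Rightarrow>\<^sub>C real) \<Rightarrow> real. 1/2 < \<phi> d}" for d
        by (intro open_Collect_less continuous_on_product_coordinates continuous_on_const)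
      \<comment> \<open>A point of \<open>K\<close> outside the union would lie in \<open>Q\<close>,
        where \<open>h\<close> vanishes, against the positive threshold.\<close>
      moreover have "K \<subseteq> (\<Union>p\<in>P. {\<phi>. 1/2 < \<phi> (snd p)})"
        using h(2) M by (fastforce simp: K_def Q_def not_le)
      ultimately obtain F where F: "F \<subseteq> P" "finite F" "K \<subseteq> (\<Union>p\<in>F. {\<phi>. 1/2 < \<phi> (snd p)})"
        using compactE_image[of K P "\<lambda>p. {\<phi>. 1/2 < \<phi> (snd p)}"] by metis
      have nonneg: "0 \<le> d x" if "(c, d) \<in> F" for c d x
        using that F(1) D(2) by (auto simp: P_def)
      txt \<open>The choice of \<open>h\<close> depends on \<open>e\<close>, so \<open>e * h\<close> need not be small where \<open>\<bar>g\<bar> \<le> e\<close>. Hence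
        \<open>g\<close> is split into its truncation \<open>u\<close>, which is small in norm, and a remainder that
        vanishes on \<open>K\<close>; convexity of \<open>C\<close> recombines the two halves.\<close>
      define g where "g = f - normalized_combination F"
      have gM: "\<bar>g x\<bar> \<le> M" for x
      proof -
        have "\<bar>normalized_combination F x\<bar> \<le> norm f + e"
          using F(1) nonneg e by (intro abs_normalized_combination_le) (auto simp: P_def)
        thus ?thesis using norm_bounded[of f x] by (simp add: g_def M_def)
      qed
      have ge: "\<bar>g x\<bar> \<le> e" if x: "stone_cech_map x \<in> K" for x
      proof -
        obtain c d where "(c, d) \<in> F" "1/2 < d x"
          using F(3) x by (force simp: stone_cech_map_def)
        thus ?thesis using F nonneg unfolding g_def
          by (auto simp: P_def intro!: normalized_combination_approx)
      qed
      have "(\<lambda>x. max (- e) (min e (g x))) \<in> bcontfun"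
        using e by (intro bcontfun_normI[of _ e] continuous_intros) (auto simp: abs_le_iff)
      then obtain u :: "'a \<Rightarrow>\<^sub>C real" where u: "apply_bcontfun u = (\<lambda>x. max (- e) (min e (g x)))"
        using Bcontfun_inverse by blast
      have "2 *\<^sub>R u \<in> W"
        using e by (intro r(2)) (auto simp: u e_def abs_le_iff)
      moreover have "2 *\<^sub>R (g - u) \<in> W"
      proof (rule h(3))
        fix x
        show "\<bar>h (stone_cech_map x) * (2 *\<^sub>R (g - u)) x\<bar> \<le> 1"
        proof (cases "stone_cech_map x \<in> K")
          case True
          hence "g x = u x" using ge[of x] by (auto simp: u)
          thus ?thesis by simp
        next
          case False
          hence "\<bar>h (stone_cech_map x)\<bar> \<le> 1 / (2 * M)"
            using stone_cech_map_in_stone_cech[of x] by (simp add: K_def)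
          moreover have "\<bar>g x - u x\<bar> \<le> \<bar>g x\<bar>"
            using e unfolding u by linarith
          hence "\<bar>(2 *\<^sub>R (g - u)) x\<bar> \<le> 2 * M"
            using gM[of x] by (simp add: abs_mult)
          ultimately have "\<bar>h (stone_cech_map x) * (2 *\<^sub>R (g - u)) x\<bar> \<le> 1 / (2 * M) * (2 * M)"
            unfolding abs_mult using M by (intro mult_mono) auto
          thus ?thesis using M by simp
        qed
      qed
      ultimately have "(1/2) *\<^sub>R (2 *\<^sub>R u) + (1/2) *\<^sub>R (2 *\<^sub>R (g - u)) \<in> C"
        using C by (intro convexD) auto
      hence "g \<in> U" using C(3) V(3) by auto
      moreover have "normalized_combination F \<in> A"
        using F by (auto simp: A_def P_def)
      ultimately show ?thesis unfolding g_def by blast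
    qed
    have "f \<in> {a + u |a u. a \<in> A \<and> u \<in> U}" for f
    proof -
      obtain a where "a \<in> A" "f - a \<in> U" using approx by blast
      moreover have "f = a + (f - a)" by simp
      ultimately show ?thesis by blast
    qed
    thus ?thesis by blast
  qed
  ultimately show ?thesis
    unfolding transseparable_def by (intro allI impI exI[of _ A]) blast
qed

end
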